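(* Let $k\in\mathbb{Z}$ and let $n \geq m \geq 1$ be integers. Then \begin{equation*} \begin{split} &\sum_{l=0}^{n-m}m!\binom{n}{l+m}S_{1}(l+m,m)C_{n-l-m}^{(k)}\\ &=\sum_{l=0}^{n-m}(m-1)!\binom{n-1}{l+m-1}S_{1}(l+m-1,m-1)\left\{(m-1)C_{n-l-m}^{(k)}(1)+C_{n-l-m}^{(k-1)}(1)\right\}. \end{split} \end{equation*}
   Context: For $k\in\mathbb{Z}$, $Lif_k(t)=\sum_{m=0}^{\infty}\frac{t^m}{m!(m+1)^k}$, and the poly-Cauchy polynomials $C_n^{(k)}(x)$ are defined by $\frac{Lif_k(\log(1+t))}{(1+t)^x}=\sum_{n=0}^\infty C_n^{(k)}(x)\frac{t^n}{n!}$; $C_n^{(k)}=C_n^{(k)}(0)$. The Stirling numbers of the first kind $S_1(l,m)$ are defined by $(\log(1+t))^m=m!\sum_{l\ge m}S_1(l,m)\frac{t^l}{l!}$ (so $S_1(0,0)=1$ and $S_1(l,0)=0$ for $l\ge1$). *)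

theory Defs
  imports "HOL-Computational_Algebra.Computational_Algebra"
begin

text \<open>
  All generating functions are formal power series in \<open>t\<close> over a field of characteristic zero.
  The library series \<^term>\<open>fps_ln 1\<close> is \<open>log(1+t)\<close> and \<^term>\<open>fps_binomial x\<close> is \<open>(1+t)\<^sup>x\<close>.
\<close>

definition Lif :: "int \<Rightarrow> 'a::field_char_0 fps" where
  "Lif k = Abs_fps (\<lambda>m. 1 / (fact m * of_nat (m + 1) powi k))"

text \<open>\<open>poly_cauchy k n x\<close> is the value at \<open>x\<close> of the polynomial \<open>C\<^sub>n\<^bsup>(k)\<^esup>\<close>.\<close>

definition poly_cauchy :: "int \<Rightarrow> nat \<Rightarrow> 'a::field_char_0 \<Rightarrow> 'a" where
  "poly_cauchy k n x = fact n * fps_nth (fps_compose (Lif k) (fps_ln 1) / fps_binomial x) n"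

text \<open>
  The signed Stirling numbers of the first kind; the library function \<open>stirling\<close>
  from \<open>HOL-Combinatorics\<close> is the unsigned version.
\<close>

definition S1 :: "nat \<Rightarrow> nat \<Rightarrow> 'a::field_char_0" where
  "S1 l m = fact l / fact m * fps_nth (fps_ln 1 ^ m) l"

lemma poly_cauchy_egf:
  "fps_compose (Lif k) (fps_ln 1) / fps_binomial x = Abs_fps (\<lambda>n. poly_cauchy k n x / fact n)"
  by (simp add: fps_eq_iff poly_cauchy_def)

lemma S1_egf:
  "fps_ln 1 ^ m = fps_const (fact m) * Abs_fps (\<lambda>l. if l \<ge> m then S1 l m / fact l else 0)"
  by (auto simp: fps_eq_iff S1_def startsby_zero_power_prefix)

lemma S1_0_right: "S1 l 0 = (if l = 0 then 1 else 0)"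
  by (simp add: S1_def)

end

theory Submission
  imports Defs
begin

text \<open>
  Both sides are coefficients of exponential generating functions. With \<open>L = log(1+t)\<close>, the left
  one generates \<open>L\<^sup>m Lif\<^sub>k(L)\<close>, and passing from \<open>n\<close> to \<open>n - 1\<close> means differentiating it. Since
  \<open>(u Lif\<^sub>k(u))' = Lif\<^bsub>k-1\<^esub>(u)\<close>, the derivative is \<open>L\<^bsup>m-1\<^esup> ((m-1) Lif\<^sub>k(L) + Lif\<^bsub>k-1\<^esub>(L)) L'\<close>, where
  the factor \<open>L' = 1/(1+t)\<close> shifts the argument of the poly-Cauchy polynomials from 0 to 1.
\<close>

definition egf :: "(nat \<Rightarrow> 'a::field_char_0) \<Rightarrow> 'a fps" where
  "egf a = Abs_fps (\<lambda>n. a n / fact n)"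

lemma egf_nth: "egf a $ n = a n / fact n"
  by (simp add: egf_def)

lemma egf_add: "egf (\<lambda>n. a n + b n) = egf a + egf b"
  by (rule fps_ext) (simp add: egf_nth add_divide_distrib)

lemma egf_const_mult: "egf (\<lambda>n. c * a n) = fps_const c * egf a"
  by (rule fps_ext) (simp add: egf_nth)

lemma egf_mult:
  "egf a * egf b = egf (\<lambda>n. \<Sum>i = 0..n. of_nat (n choose i) * a i * b (n - i))"
  by (rule fps_ext) (simp add: egf_nth fps_mult_nth sum_divide_distrib binomial_fact)

lemma fact_Suc_mult_fps_nth:
  fixes F :: "'a::{comm_semiring_1, semiring_char_0} fps"
  shows "fact (Suc n) * F $ Suc n = fact n * fps_deriv F $ n"
  by (simp add: mult_ac del: of_nat_Suc)

lemma S1_eq_0: "l < m \<Longrightarrow> S1 l m = 0"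
  by (simp add: S1_def startsby_zero_power_prefix)

lemma egf_S1: "egf (\<lambda>l. fact m * S1 l m) = fps_ln 1 ^ m"
  by (rule fps_ext) (simp add: egf_nth S1_def)

lemma S1_binomial_convolution:
  assumes "m \<le> n"
  shows "(\<Sum>l = 0..n - m. fact m * of_nat (n choose (l + m)) * S1 (l + m) m * a (n - l - m)) =
    fact n * (fps_ln 1 ^ m * egf a) $ n"
proof -
  let ?f = "\<lambda>i. of_nat (n choose i) * (fact m * S1 i m) * a (n - i)"
  have "fact n * (fps_ln 1 ^ m * egf a) $ n = (\<Sum>i = 0..n. ?f i)"
    by (simp add: egf_S1[symmetric] egf_mult egf_nth)
  also have "\<dots> = (\<Sum>i = m..n. ?f i)"
    by (rule sum.mono_neutral_right) (auto simp: S1_eq_0)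
  also have "\<dots> = (\<Sum>l = 0..n - m. ?f (l + m))"
    using sum.shift_bounds_cl_nat_ivl[of ?f 0 m "n - m"] assms by simp
  finally show ?thesis
    by (simp add: ac_simps)
qed

lemma fps_deriv_power_Suc_mult:
  fixes f g :: "'a::comm_semiring_1 fps"
  shows "fps_deriv (f ^ Suc p * g) = f ^ p * (of_nat p * (g * fps_deriv f) + fps_deriv (f * g))"
proof (induction p)
  case (Suc p)
  have "fps_deriv (f ^ Suc (Suc p) * g) = fps_deriv (f * (f ^ Suc p * g))"
    by (simp only: power_Suc mult.assoc)
  also have "\<dots> = f * fps_deriv (f ^ Suc p * g) + fps_deriv f * (f ^ Suc p * g)"
    by (rule fps_deriv_mult)
  finally show ?case
    by (simp only: Suc.IH) (simp add: algebra_simps)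
qed simp

lemma fps_deriv_X_mult_Lif:
  "fps_deriv (fps_X * Lif k) = (Lif (k - 1) :: 'a::field_char_0 fps)"
proof (rule fps_ext)
  fix n
  have "(of_nat (Suc n) :: 'a) \<noteq> 0"
    by (rule of_nat_neq_0)
  then show "fps_deriv (fps_X * Lif k) $ n = (Lif (k - 1) :: 'a fps) $ n"
    by (simp add: Lif_def power_int_diff fps_deriv_nth del: of_nat_Suc fps_deriv_mult)
qed

lemma fps_deriv_mult_Lif_compose:
  assumes "f $ 0 = 0"
  shows "fps_deriv (f * (Lif k oo f)) = (Lif (k - 1) oo f) * fps_deriv f"
proof -
  have "f * (Lif k oo f) = (fps_X * Lif k) oo f"
    using assms by (simp add: fps_compose_mult_distrib)
  then show ?thesis
    using assms by (simp only: fps_compose_deriv fps_deriv_X_mult_Lif)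
qed

lemma egf_poly_cauchy_0: "egf (\<lambda>n. poly_cauchy k n 0) = Lif k oo fps_ln 1"
  by (simp add: egf_def poly_cauchy_egf[symmetric])

lemma egf_poly_cauchy_1:
  "egf (\<lambda>n. poly_cauchy k n 1) = (Lif k oo fps_ln 1) * fps_deriv (fps_ln 1)"
  by (simp add: egf_def poly_cauchy_egf[symmetric] fps_binomial_1 fps_divide_unit fps_ln_deriv)

lemma fps_deriv_ln_power_mult_egf_poly_cauchy:
  "fps_deriv (fps_ln 1 ^ Suc p * egf (\<lambda>n. poly_cauchy k n 0)) =
     fps_ln 1 ^ p * egf (\<lambda>n. of_nat p * poly_cauchy k n 1 + poly_cauchy (k - 1) n 1)"
  by (simp only: egf_add egf_const_mult egf_poly_cauchy_0 egf_poly_cauchy_1 fps_of_nat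
      fps_deriv_power_Suc_mult fps_deriv_mult_Lif_compose[OF fps_ln_0])

theorem theorem5:
  fixes k :: int and n m :: nat
  assumes "1 \<le> m" and "m \<le> n"
  shows "(\<Sum>l = 0..n - m. fact m * of_nat (n choose (l + m)) * S1 (l + m) m
             * poly_cauchy k (n - l - m) (0 :: 'a::field_char_0))
       = (\<Sum>l = 0..n - m. fact (m - 1) * of_nat ((n - 1) choose (l + m - 1)) * S1 (l + m - 1) (m - 1)
             * (of_nat (m - 1) * poly_cauchy k (n - l - m) 1 + poly_cauchy (k - 1) (n - l - m) 1))"
proof -
  obtain p where m_eq: "m = Suc p" using assms by (cases m) auto
  obtain q where n_eq: "n = Suc q" using assms by (cases n) auto
  have "p \<le> q" using assms m_eq n_eq by simp
  let ?C = "egf (\<lambda>i. poly_cauchy k i 0) :: 'a fps"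
  let ?D = "\<lambda>i. of_nat p * poly_cauchy k i 1 + poly_cauchy (k - 1) i 1 :: 'a"
  have "(\<Sum>l = 0..n - m. fact m * of_nat (n choose (l + m)) * S1 (l + m) m
             * poly_cauchy k (n - l - m) (0 :: 'a)) = fact n * (fps_ln 1 ^ m * ?C) $ n"
    using assms(2) by (rule S1_binomial_convolution)
  also have "\<dots> = fact q * fps_deriv (fps_ln 1 ^ Suc p * ?C) $ q"
    unfolding m_eq n_eq by (rule fact_Suc_mult_fps_nth)
  also have "\<dots> = fact q * (fps_ln 1 ^ p * egf ?D) $ q"
    by (simp only: fps_deriv_ln_power_mult_egf_poly_cauchy)
  also have "\<dots> = (\<Sum>l = 0..q - p. fact p * of_nat (q choose (l + p)) * S1 (l + p) p
             * ?D (q - l - p))"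
    using \<open>p \<le> q\<close> by (rule S1_binomial_convolution[symmetric])
  finally show ?thesis
    by (simp add: m_eq n_eq)
qed

end
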